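(* For every integer $n\ge 1$, $$\mathrm{pf}_n(123,231)=\binom{n+1}{3}+\binom{n}{2}+1.$$
   Context: A Dyck path of semilength $n$ is a lattice path from $(0,0)$ to $(n,n)$ consisting of $n$ north steps $N=(0,1)$ and $n$ east steps $E=(1,0)$ that never goes below the line $y=x$. A parking function of size $n$ is a Dyck path of semilength $n$ whose $n$ north steps are labeled bijectively by $\{1,\dots,n\}$ so that whenever two north steps are consecutive in the path (one immediately following the other), the label of the later one is larger. For a parking function $p$ of size $n$, $\phi(p)$ is the permutation of $\{1,\dots,n\}$ (in one-line notation) obtained by reading the labels of the north steps in the order they occur along the path. A permutation $\pi$ of $\{1,\dots,n\}$ contains a permutation $\rho$ of $\{1,\dots,m\}$ if there are indices $1\le i_1<\cdots<i_m\le n$ such that $\pi_{i_a}\le\pi_{i_b}$ if and only if $\rho_a\le\rho_b$; otherwise $\pi$ avoids $\rho$. For permutations $\rho_1,\dots,\rho_r$, $\mathrm{pf}_n(\rho_1,\dots,\rho_r)$ denotes the number of parking functions $p$ of size $n$ such that $\phi(p)$ avoids each of $\rho_1,\dots,\rho_r$. Binomial coefficients $\binom{a}{b}$ with $0\le a<b$ are $0$. *)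

theory Defs
  imports Main
begin

datatype step = North | East

definition dyck_path :: "nat \<Rightarrow> step list \<Rightarrow> bool" where
  "dyck_path n w \<longleftrightarrow>
     count_list w North = n \<and> count_list w East = n \<and>
     (\<forall>k \<le> length w. count_list (take k w) East \<le> count_list (take k w) North)"

datatype lstep = LNorth nat | LEast

fun unlabel :: "lstep \<Rightarrow> step" where
  "unlabel (LNorth a) = North"
| "unlabel LEast = East"

fun north_labels :: "lstep list \<Rightarrow> nat list" where
  "north_labels [] = []"
| "north_labels (LNorth a # p) = a # north_labels p"
| "north_labels (LEast # p) = north_labels p"

text \<open>In a Dyck path of semilength \<open>n\<close> there are \<open>n\<close> north steps, so the labelling is a
  bijection onto \<open>{1..n}\<close> iff the labels are distinct and exhaust \<open>{1..n}\<close>.\<close>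

definition parking_function :: "nat \<Rightarrow> lstep list \<Rightarrow> bool" where
  "parking_function n p \<longleftrightarrow>
     dyck_path n (map unlabel p) \<and>
     distinct (north_labels p) \<and> set (north_labels p) = {1..n} \<and>
     (\<forall>i a b. Suc i < length p \<and> p ! i = LNorth a \<and> p ! Suc i = LNorth b \<longrightarrow> a < b)"

definition phi :: "lstep list \<Rightarrow> nat list" where
  "phi p = north_labels p"

text \<open>Permutations are lists in one-line notation; positions are counted from 0, and
  \<open>f\<close> is the choice of indices \<open>i\<^sub>1 < \<dots> < i\<^sub>m\<close>.\<close>

definition contains :: "nat list \<Rightarrow> nat list \<Rightarrow> bool" where
  "contains \<pi> \<rho> \<longleftrightarrow>
     (\<exists>f :: nat \<Rightarrow> nat.
        strict_mono_on {..<length \<rho>} f \<and> f ` {..<length \<rho>} \<subseteq> {..<length \<pi>} \<and>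
        (\<forall>a < length \<rho>. \<forall>b < length \<rho>. \<pi> ! f a \<le> \<pi> ! f b \<longleftrightarrow> \<rho> ! a \<le> \<rho> ! b))"

abbreviation avoids :: "nat list \<Rightarrow> nat list \<Rightarrow> bool" where
  "avoids \<pi> \<rho> \<equiv> \<not> contains \<pi> \<rho>"

definition pf :: "nat \<Rightarrow> nat list set \<Rightarrow> nat" where
  "pf n R = card {p. parking_function n p \<and> (\<forall>\<rho> \<in> R. avoids (phi p) \<rho>)}"

end

theory Submission imports Defs begin

text \<open>In an avoiding permutation of \<open>{1..n + 1}\<close> everything before the maximum is
  smaller than everything after it, and if something does precede the maximum, both parts
  decrease. So either the maximum comes first, or the word is \<open>k \<dots> 1 (n+1) \<dots> (k+1)\<close>
  for some \<open>1 \<le> k \<le> n\<close>. On the side of paths, every descent of the labels forces an east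
  step. A path on the diagonal that meets a descent therefore returns to the diagonal at
  once, so a leading maximum does not change the number of paths, and only the single
  ascent of \<open>k \<dots> 1 (n+1) \<dots> (k+1)\<close> leaves a choice: the path returns to the diagonal
  immediately or after one of the \<open>n + 1 - k\<close> later north steps. Hence the total count grows by
  \<open>\<Sum>k = 1..n. n + 2 - k\<close> from \<open>n\<close> to \<open>n + 1\<close>.\<close>

section \<open>Completions of a partial parking function\<close>

text \<open>\<open>d\<close> is the height of the path above the diagonal at the point where the completion
  starts.\<close>

fun completes :: "nat \<Rightarrow> lstep list \<Rightarrow> bool" where
  "completes d [] \<longleftrightarrow> d = 0"
| "completes d (LEast # p) \<longleftrightarrow> d > 0 \<and> completes (d - 1) p"
| "completes d (LNorth a # p) \<longleftrightarrow>
     (case p of LNorth b # _ \<Rightarrow> a < b | _ \<Rightarrow> True) \<and> completes (Suc d) p"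

definition completions :: "nat \<Rightarrow> nat list \<Rightarrow> lstep list set" where
  "completions d \<pi> = {p. completes d p \<and> north_labels p = \<pi>}"

text \<open>The label condition as a relation on adjacent steps, so that \<open>successively\<close>
  can express it.\<close>

definition labels_ok :: "lstep \<Rightarrow> lstep \<Rightarrow> bool" where
  "labels_ok x y \<longleftrightarrow> (\<forall>a b. x = LNorth a \<and> y = LNorth b \<longrightarrow> a < b)"

lemma labels_ok_simps [simp]:
  "labels_ok LEast y" "labels_ok x LEast" "labels_ok (LNorth a) (LNorth b) \<longleftrightarrow> a < b"
  by (auto simp: labels_ok_def)

lemma all_le_Suc_conv: "(\<forall>k \<le> Suc m. P k) \<longleftrightarrow> P 0 \<and> (\<forall>k \<le> m. P (Suc k))"
  by (metis Suc_le_mono not0_implies_Suc zero_le)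

text \<open>Links the recursion to the prefix condition of \<open>dyck_path\<close>, which is the
  case \<open>d = 0\<close>: peeling off a step shortens every prefix by one and moves the starting
  height by one.\<close>

lemma completes_iff:
  "completes d p \<longleftrightarrow>
     count_list (map unlabel p) East = d + count_list (map unlabel p) North \<and>
     (\<forall>k \<le> length p. count_list (take k (map unlabel p)) East
        \<le> d + count_list (take k (map unlabel p)) North) \<and>
     successively labels_ok p"
proof (induction d p rule: completes.induct)
  case (2 d p)
  have "successively labels_ok (LEast # p) = successively labels_ok p"
    by (cases p) auto
  then show ?case
    \<comment> \<open>For \<open>d = 0\<close> the prefix of length 1 already violates the
      bound.\<close>
    using 2 by (cases d) (auto simp: all_le_Suc_conv)
next
  case (3 d a p)
  have "successively labels_ok (LNorth a # p) \<longleftrightarrow>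
      (case p of LNorth b # _ \<Rightarrow> a < b | _ \<Rightarrow> True) \<and> successively labels_ok p"
    by (auto split: list.split lstep.split)
  then show ?case
    using 3 by (auto simp: all_le_Suc_conv)
qed auto

lemma count_North_eq: "count_list (map unlabel p) North = length (north_labels p)"
  by (induction p rule: north_labels.induct) auto

lemma successively_labels_ok:
  "successively labels_ok p \<longleftrightarrow>
    (\<forall>i a b. Suc i < length p \<and> p ! i = LNorth a \<and> p ! Suc i = LNorth b \<longrightarrow> a < b)"
  unfolding successively_conv_nth labels_ok_def by blast

text \<open>Distinct labels with set \<open>{1..n}\<close> number exactly \<open>n\<close>, which
  fixes both step counts of a completion from height 0.\<close>

lemma parking_function_iff:
  "parking_function n p \<longleftrightarrow>
     completes 0 p \<and> distinct (north_labels p) \<and> set (north_labels p) = {1..n}"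
proof -
  have "length (north_labels p) = n"
    if "distinct (north_labels p)" "set (north_labels p) = {1..n}"
    using that distinct_card by fastforce
  then show ?thesis
    unfolding parking_function_def dyck_path_def completes_iff successively_labels_ok
    by (auto simp: count_North_eq)
qed

lemma completes_length: "completes d p \<Longrightarrow> length p = d + 2 * length (north_labels p)"
  by (induction d p rule: completes.induct) auto

lemma set_subset_north_labels: "set p \<subseteq> insert LEast (LNorth ` set (north_labels p))"
  by (induction p rule: north_labels.induct) auto

text \<open>The word \<open>\<pi>\<close> fixes the length of a completion as well as its
  alphabet.\<close>

lemma finite_completions: "finite (completions d \<pi>)"
proof (rule finite_subset)
  show "completions d \<pi> \<subseteq> {p. set p \<subseteq> insert LEast (LNorth ` set \<pi>) \<and> length p = d + 2 * length \<pi>}"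
    using completes_length set_subset_north_labels unfolding completions_def by blast
qed (intro finite_lists_length_eq, simp)

lemma Nil_in_completions: "[] \<in> completions d \<pi> \<longleftrightarrow> d = 0 \<and> \<pi> = []"
  by (auto simp: completions_def)

lemma LEast_in_completions: "LEast # p \<in> completions d \<pi> \<longleftrightarrow> d > 0 \<and> p \<in> completions (d - 1) \<pi>"
  by (auto simp: completions_def)

lemma LNorth_in_completions:
  "LNorth a # p \<in> completions d \<pi> \<longleftrightarrow>
     (\<exists>\<rho>. \<pi> = a # \<rho> \<and> p \<in> completions (Suc d) \<rho> \<and> (\<forall>b q. p = LNorth b # q \<longrightarrow> a < b))"
proof -
  have "(case p of LNorth b # _ \<Rightarrow> a < b | _ \<Rightarrow> True) \<longleftrightarrow> (\<forall>b q. p = LNorth b # q \<longrightarrow> a < b)"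
    by (cases p rule: north_labels.cases) simp_all
  then show ?thesis
    unfolding completions_def mem_Collect_eq completes.simps north_labels.simps by blast
qed

section \<open>Completions forced by descents\<close>

lemma completions_0_Nil: "completions 0 [] = {[]}"
proof -
  have "p \<in> completions 0 [] \<longleftrightarrow> p = []" for p
    by (cases p rule: north_labels.cases)
      (simp_all add: Nil_in_completions LEast_in_completions LNorth_in_completions)
  then show ?thesis by blast
qed

lemma completions_0_cases:
  assumes "p \<in> completions 0 (a # \<pi>)"
  obtains q where "p = LNorth a # q"
  using assms
  by (cases p rule: north_labels.cases)
    (auto simp: Nil_in_completions LEast_in_completions LNorth_in_completions)

text \<open>After the step the path stands at height \<open>d + 1\<close>, so it cannot end, and
  another north step would carry the label \<open>hd \<pi> < a\<close>. Only an east step is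
  left.\<close>

lemma LNorth_in_completions_descent:
  assumes "\<pi> \<noteq> [] \<Longrightarrow> hd \<pi> < a"
  shows "LNorth a # p \<in> completions d (a # \<pi>) \<longleftrightarrow> (\<exists>q. p = LEast # q \<and> q \<in> completions d \<pi>)"
  using assms
  by (cases p rule: north_labels.cases)
    (auto simp: Nil_in_completions LEast_in_completions LNorth_in_completions)

lemma completions_0_descent:
  assumes "\<pi> \<noteq> [] \<Longrightarrow> hd \<pi> < a"
  shows "completions 0 (a # \<pi>) = (\<lambda>q. LNorth a # LEast # q) ` completions 0 \<pi>"
proof (intro set_eqI iffI)
  fix p assume p: "p \<in> completions 0 (a # \<pi>)"
  then obtain q where "p = LNorth a # q" by (rule completions_0_cases)
  then show "p \<in> (\<lambda>q. LNorth a # LEast # q) ` completions 0 \<pi>"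
    using p LNorth_in_completions_descent[OF assms] by auto
next
  fix p assume "p \<in> (\<lambda>q. LNorth a # LEast # q) ` completions 0 \<pi>"
  then show "p \<in> completions 0 (a # \<pi>)"
    using LNorth_in_completions_descent[OF assms] by auto
qed

lemma card_completions_0_descent:
  assumes "\<pi> \<noteq> [] \<Longrightarrow> hd \<pi> < a"
  shows "card (completions 0 (a # \<pi>)) = card (completions 0 \<pi>)"
  by (subst completions_0_descent) (auto simp: assms card_image inj_on_def)

text \<open>Each letter of \<open>xs\<close> is followed by a smaller one and can be stripped;
  \<open>a\<close> stays, since nothing relates it to \<open>ys\<close>.\<close>

lemma card_completions_0_descents:
  assumes "sorted_wrt (>) (xs @ [a])"
  shows "card (completions 0 (xs @ a # ys)) = card (completions 0 (a # ys))"
  using assms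
proof (induction xs)
  case (Cons x xs)
  then have "hd (xs @ a # ys) < x" by (cases xs) auto
  then show ?case using Cons by (simp add: card_completions_0_descent)
qed simp

lemma card_completions_0_decreasing:
  assumes "sorted_wrt (>) \<pi>"
  shows "card (completions 0 \<pi>) = 1"
  using assms
proof (induction \<pi>)
  case (Cons a \<pi>)
  then show ?case by (subst card_completions_0_descent) auto
qed (simp add: completions_0_Nil)

section \<open>Completions from height 1\<close>

text \<open>From height 1 an east step leads back to the diagonal and to
  \<open>completions 0\<close>; this set collects the other completions, those that delay the
  return.\<close>

definition north_completions :: "nat list \<Rightarrow> lstep list set" where
  "north_completions \<pi> = {p \<in> completions 1 \<pi>. \<exists>b q. p = LNorth b # q}"

lemma north_completions_Nil: "north_completions [] = {}"
  by (auto simp: north_completions_def LNorth_in_completions)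

lemma completions_1: "completions 1 \<pi> = (#) LEast ` completions 0 \<pi> \<union> north_completions \<pi>"
proof -
  have "p \<in> completions 1 \<pi> \<longleftrightarrow> p \<in> (#) LEast ` completions 0 \<pi> \<union> north_completions \<pi>" for p
    by (cases p rule: north_labels.cases)
      (auto simp: north_completions_def Nil_in_completions LEast_in_completions)
  then show ?thesis by blast
qed

lemma card_completions_1:
  "card (completions 1 \<pi>) = card (completions 0 \<pi>) + card (north_completions \<pi>)"
proof -
  have "card ((#) LEast ` completions 0 \<pi>) = card (completions 0 \<pi>)"
    by (rule card_image) auto
  then show ?thesis
    unfolding completions_1
    by (subst card_Un_disjoint)
       (auto simp: finite_completions north_completions_def)
qed

lemma north_completions_Cons:
  assumes "\<pi> \<noteq> [] \<Longrightarrow> hd \<pi> < a"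
  shows "north_completions (a # \<pi>) = (\<lambda>q. LNorth a # LEast # q) ` completions 1 \<pi>"
proof -
  have "north_completions (a # \<pi>) = {p. \<exists>q. p = LNorth a # q \<and> LNorth a # q \<in> completions 1 (a # \<pi>)}"
    by (auto simp: north_completions_def LNorth_in_completions)
  also have "\<dots> = (\<lambda>q. LNorth a # LEast # q) ` completions 1 \<pi>"
    by (auto simp: LNorth_in_completions_descent[OF assms])
  finally show ?thesis .
qed

text \<open>In a decreasing word a north step from height 1 is followed by an east step back to
  height 1. There the path either returns to the diagonal, with a single completion, or goes north
  again, so each letter contributes one.\<close>

lemma card_north_completions:
  assumes "sorted_wrt (>) \<pi>"
  shows "card (north_completions \<pi>) = length \<pi>"
  using assms
proof (induction \<pi>)
  case (Cons a \<pi>)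
  then have "\<pi> \<noteq> [] \<Longrightarrow> hd \<pi> < a" by auto
  then have "card (north_completions (a # \<pi>)) = card (completions 1 \<pi>)"
    by (subst north_completions_Cons) (auto simp: card_image inj_on_def)
  then show ?case
    using Cons by (simp add: card_completions_1 card_completions_0_decreasing del: One_nat_def)
qed (simp add: north_completions_Nil)

text \<open>The ascent leaves the step after \<open>a\<close> free, so any completion from height 1
  may follow: one that returns to the diagonal at once, or one of \<open>length \<pi>\<close> many
  that return later.\<close>

lemma card_completions_0_ascent:
  assumes "sorted_wrt (>) \<pi>" "\<pi> \<noteq> []" "a < hd \<pi>"
  shows "card (completions 0 (a # \<pi>)) = Suc (length \<pi>)"
proof -
  have "completions 0 (a # \<pi>) = (#) (LNorth a) ` completions 1 \<pi>"
  proof (intro set_eqI iffI)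
    fix p assume p: "p \<in> completions 0 (a # \<pi>)"
    then obtain q where "p = LNorth a # q" by (rule completions_0_cases)
    then show "p \<in> (#) (LNorth a) ` completions 1 \<pi>"
      using p by (auto simp: LNorth_in_completions)
  next
    fix p assume "p \<in> (#) (LNorth a) ` completions 1 \<pi>"
    then show "p \<in> completions 0 (a # \<pi>)"
      using assms(3) by (auto simp: LNorth_in_completions)
  qed
  then have "card (completions 0 (a # \<pi>)) = card (completions 1 \<pi>)"
    by (simp add: card_image)
  then show ?thesis
    using assms(1) by (simp add: card_completions_1 card_completions_0_decreasing card_north_completions del: One_nat_def)
qed

section \<open>Permutations avoiding 123 and 231\<close>

text \<open>A strictly increasing index map on three points is a triple \<open>i < j < k\<close>;
  conversely, lookup in \<open>[i, j, k]\<close> is such a map.\<close>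

lemma contains_3_iff:
  "contains \<pi> [u, v, w] \<longleftrightarrow>
     (\<exists>i j k. i < j \<and> j < k \<and> k < length \<pi> \<and>
        (\<forall>a < 3. \<forall>b < 3. \<pi> ! ([i, j, k] ! a) \<le> \<pi> ! ([i, j, k] ! b) \<longleftrightarrow> [u, v, w] ! a \<le> [u, v, w] ! b))"
    (is "?L \<longleftrightarrow> ?R")
proof
  assume ?L
  then obtain f where f: "strict_mono_on {..<3} f" "f ` {..<3} \<subseteq> {..<length \<pi>}"
    "\<forall>a < 3. \<forall>b < 3. \<pi> ! f a \<le> \<pi> ! f b \<longleftrightarrow> [u, v, w] ! a \<le> [u, v, w] ! b"
    by (auto simp: contains_def numeral_3_eq_3)
  have "f 0 < f 1" "f 1 < f 2" "f 2 < length \<pi>"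
    using f(1,2) by (auto simp: strict_mono_on_def image_subset_iff)
  moreover have "[f 0, f 1, f 2] ! a = f a" if "a < 3" for a
    using that by (auto simp: less_Suc_eq numeral_3_eq_3 numeral_2_eq_2)
  ultimately show ?R using f(3) by metis
next
  assume ?R
  then obtain i j k where ijk: "i < j" "j < k" "k < length \<pi>"
    "\<forall>a < 3. \<forall>b < 3. \<pi> ! ([i, j, k] ! a) \<le> \<pi> ! ([i, j, k] ! b) \<longleftrightarrow> [u, v, w] ! a \<le> [u, v, w] ! b"
    by blast
  have "strict_mono_on {..<3} ((!) [i, j, k])" "(!) [i, j, k] ` {..<3} \<subseteq> {..<length \<pi>}"
    using ijk(1-3) by (auto simp: strict_mono_on_def less_Suc_eq numeral_3_eq_3)
  then show ?L
    unfolding contains_def using ijk(4) by (intro exI[of _ "(!) [i, j, k]"]) (simp add: numeral_3_eq_3)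
qed

lemma all_less_3: "(\<forall>a < 3. P a) \<longleftrightarrow> P 0 \<and> P 1 \<and> P (2 :: nat)"
  by (auto simp: less_Suc_eq numeral_3_eq_3 numeral_2_eq_2)

lemma contains_123: "contains \<pi> [1, 2, 3] \<longleftrightarrow>
    (\<exists>i j k. i < j \<and> j < k \<and> k < length \<pi> \<and> \<pi> ! i < \<pi> ! j \<and> \<pi> ! j < \<pi> ! k)"
  unfolding contains_3_iff all_less_3 by (rule iff_exI)+ auto

lemma contains_231: "contains \<pi> [2, 3, 1] \<longleftrightarrow>
    (\<exists>i j k. i < j \<and> j < k \<and> k < length \<pi> \<and> \<pi> ! k < \<pi> ! i \<and> \<pi> ! i < \<pi> ! j)"
  unfolding contains_3_iff all_less_3 by (rule iff_exI)+ auto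

text \<open>The pairs after \<open>a\<close> that are excluded are those completing a 123 or a 231
  that starts with \<open>a\<close>.\<close>

fun avoiding :: "nat list \<Rightarrow> bool" where
  "avoiding [] \<longleftrightarrow> True"
| "avoiding (a # xs) \<longleftrightarrow>
     sorted_wrt (\<lambda>b c. (a < b \<longrightarrow> \<not> b < c) \<and> (c < a \<longrightarrow> \<not> a < b)) xs \<and> avoiding xs"

text \<open>Since \<open>j\<close> and \<open>k\<close> are never 0, a triple either has the head as
  its first entry or lies in the tail. This is the recursion of \<open>avoiding\<close>.\<close>

lemma all_triples_Cons:
  "(\<forall>i j k. i < j \<longrightarrow> j < k \<longrightarrow> k < length (x # xs) \<longrightarrow> P ((x # xs) ! i) ((x # xs) ! j) ((x # xs) ! k)) \<longleftrightarrow>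
     (\<forall>j k. j < k \<longrightarrow> k < length xs \<longrightarrow> P x (xs ! j) (xs ! k)) \<and>
     (\<forall>i j k. i < j \<longrightarrow> j < k \<longrightarrow> k < length xs \<longrightarrow> P (xs ! i) (xs ! j) (xs ! k))"
  (is "?L \<longleftrightarrow> ?R1 \<and> ?R2")
proof
  assume L: ?L
  have ?R1
  proof (intro allI impI)
    fix j k assume "j < k" "k < length xs"
    then show "P x (xs ! j) (xs ! k)" using L[rule_format, of 0 "Suc j" "Suc k"] by simp
  qed
  moreover have ?R2
  proof (intro allI impI)
    fix i j k assume "i < j" "j < k" "k < length xs"
    then show "P (xs ! i) (xs ! j) (xs ! k)"
      using L[rule_format, of "Suc i" "Suc j" "Suc k"] by simp
  qed
  ultimately show "?R1 \<and> ?R2" ..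
next
  assume R: "?R1 \<and> ?R2"
  show ?L
  proof (intro allI impI)
    fix i j k assume ijk: "i < j" "j < k" "k < length (x # xs)"
    then obtain j' k' where "j = Suc j'" "k = Suc k'"
      by (metis less_imp_Suc_add)
    then show "P ((x # xs) ! i) ((x # xs) ! j) ((x # xs) ! k)"
      using R ijk by (cases i) auto
  qed
qed

lemma avoiding_iff_nth:
  "avoiding xs \<longleftrightarrow> (\<forall>i j k. i < j \<longrightarrow> j < k \<longrightarrow> k < length xs \<longrightarrow>
     (xs ! i < xs ! j \<longrightarrow> \<not> xs ! j < xs ! k) \<and> (xs ! k < xs ! i \<longrightarrow> \<not> xs ! i < xs ! j))"
proof (induction xs)
  case (Cons x xs)
  show ?case
    unfolding avoiding.simps Cons.IH sorted_wrt_iff_nth_less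
    by (subst all_triples_Cons[where P = "\<lambda>a b c. (a < b \<longrightarrow> \<not> b < c) \<and> (c < a \<longrightarrow> \<not> a < b)"]) blast
qed simp

lemma avoiding_iff: "avoiding \<pi> \<longleftrightarrow> avoids \<pi> [1, 2, 3] \<and> avoids \<pi> [2, 3, 1]"
  unfolding contains_123 contains_231 avoiding_iff_nth by blast

section \<open>Decreasing runs and the two patterns\<close>

text \<open>If \<open>xs\<close> lies below \<open>a\<close>, no \<open>b\<close> exceeds
  \<open>a\<close>. If it lies above, no \<open>c\<close> is smaller than \<open>a\<close>, and a
  123 would need an ascent in \<open>xs\<close>.\<close>

lemma sorted_wrt_avoiding_decreasing:
  fixes a :: nat
  assumes "sorted_wrt (>) xs" "(\<forall>x \<in> set xs. x < a) \<or> (\<forall>x \<in> set xs. a < x)"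
  shows "sorted_wrt (\<lambda>b c. (a < b \<longrightarrow> \<not> b < c) \<and> (c < a \<longrightarrow> \<not> a < b)) xs"
  using assms by (induction xs) auto

lemma avoiding_decreasing: "sorted_wrt (>) xs \<Longrightarrow> avoiding xs"
  by (induction xs) (simp_all add: sorted_wrt_avoiding_decreasing)

text \<open>The head \<open>x\<close> exceeds the rest of its run, so a forbidden pair after it
  would have to lie in \<open>ys\<close>, which decreases above \<open>x\<close>.\<close>

lemma avoiding_append_decreasing:
  assumes "sorted_wrt (>) xs" "sorted_wrt (>) ys" "\<forall>x \<in> set xs. \<forall>y \<in> set ys. x < y"
  shows "avoiding (xs @ ys)"
  using assms
proof (induction xs)
  case (Cons x xs)
  then show ?case
    by (auto simp: sorted_wrt_append sorted_wrt_avoiding_decreasing)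
qed (simp add: avoiding_decreasing)

text \<open>Otherwise \<open>x\<close>, \<open>m\<close>, \<open>y\<close> form a 231.\<close>

lemma avoiding_before_after:
  assumes "avoiding (xs @ m # ys)" "\<forall>x \<in> set xs. x < m" "x \<in> set xs" "y \<in> set ys"
  shows "x \<le> y"
  using assms by (induction xs) (auto simp: sorted_wrt_append)

text \<open>An ascent \<open>a < b\<close> in \<open>xs\<close> extends by \<open>m\<close> to a
  123.\<close>

lemma avoiding_before_decreasing:
  assumes "avoiding (xs @ m # ys)" "\<forall>x \<in> set xs. x < m" "distinct xs"
  shows "sorted_wrt (>) xs"
  using assms
proof (induction xs)
  case (Cons a xs)
  have "b < a" if "b \<in> set xs" for b
  proof -
    have "\<not> a < b" using Cons.prems(1,2) that by (simp add: sorted_wrt_append)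
    moreover have "a \<noteq> b" using Cons.prems(3) that by auto
    ultimately show ?thesis by simp
  qed
  then show ?case using Cons by simp
qed simp

text \<open>With \<open>x\<close> in front, an ascent in \<open>ys\<close> completes a 123.\<close>

lemma avoiding_after_decreasing:
  assumes "avoiding (x # ys)" "\<forall>y \<in> set ys. x < y" "distinct ys"
  shows "sorted_wrt (>) ys"
proof -
  have "sorted_wrt (\<lambda>b c. \<not> (x < b \<and> b < c) \<and> b \<noteq> c) ys"
    using assms by (auto simp: distinct_conv_nth sorted_wrt_iff_nth_less)
  then show ?thesis
    by (rule sorted_wrt_mono_rel[rotated]) (use assms(2) in force)
qed

section \<open>Classification of the avoiding permutations\<close>

definition avoiding_perms :: "nat \<Rightarrow> nat list set" where
  "avoiding_perms n = {\<pi>. distinct \<pi> \<and> set \<pi> = {1..n} \<and> avoiding \<pi>}"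

text \<open>Only \<open>1 \<le> k < n\<close> is counted below: \<open>k = 0\<close> and
  \<open>k = n\<close> both give the decreasing word.\<close>

definition two_runs :: "nat \<Rightarrow> nat \<Rightarrow> nat list" where
  "two_runs n k = rev [1..<Suc k] @ rev [Suc k..<Suc n]"

lemma sorted_wrt_greater_rev_upt: "sorted_wrt (>) (rev [i..<j])"
  by (simp add: sorted_wrt_rev)

lemma decreasing_eq_rev_upt:
  assumes "sorted_wrt (>) xs" "set xs = {i..<j}"
  shows "xs = rev [i..<j]"
proof -
  have "rev xs = [i..<j]"
    using assms by (intro strict_sorted_equal) (auto simp: sorted_wrt_rev)
  then show ?thesis by (metis rev_rev_ident)
qed

lemma avoiding_perms_0: "avoiding_perms 0 = {[]}"
  by (auto simp: avoiding_perms_def)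

lemma two_runs_in_avoiding_perms:
  assumes "k \<le> n"
  shows "two_runs n k \<in> avoiding_perms n"
proof -
  have "avoiding (two_runs n k)"
    unfolding two_runs_def
    by (intro avoiding_append_decreasing sorted_wrt_greater_rev_upt) auto
  then show ?thesis
    using assms by (auto simp: avoiding_perms_def two_runs_def)
qed

text \<open>The first letter of a 123 is its smallest and that of a 231 its middle one, so neither
  can start with the maximum.\<close>

lemma avoiding_Cons_greater:
  assumes "avoiding xs" "\<forall>x \<in> set xs. x < m"
  shows "avoiding (m # xs)"
proof -
  have "sorted_wrt (\<lambda>b c. (m < b \<longrightarrow> \<not> b < c) \<and> (c < m \<longrightarrow> \<not> m < b)) xs"
    using assms(2) by (induction xs) auto
  then show ?thesis using assms(1) by simp
qed

lemma Cons_in_avoiding_perms: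
  assumes "\<pi> \<in> avoiding_perms n"
  shows "Suc n # \<pi> \<in> avoiding_perms (Suc n)"
proof -
  have \<pi>: "distinct \<pi>" "set \<pi> = {1..n}" "avoiding \<pi>"
    using assms by (auto simp: avoiding_perms_def)
  then have "avoiding (Suc n # \<pi>)"
    by (intro avoiding_Cons_greater) auto
  then show ?thesis
    unfolding avoiding_perms_def using \<pi> by (simp add: atLeastAtMostSuc_conv)
qed

lemma avoiding_perms_Suc_cases:
  assumes "\<pi> \<in> avoiding_perms (Suc n)"
  shows "\<pi> \<in> (#) (Suc n) ` avoiding_perms n \<union> two_runs (Suc n) ` {1..n}"
proof -
  have \<pi>: "distinct \<pi>" "set \<pi> = {1..Suc n}" "avoiding \<pi>"
    using assms by (auto simp: avoiding_perms_def)
  then have "Suc n \<in> set \<pi>" by simp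
  then obtain xs ys where split: "\<pi> = xs @ Suc n # ys"
    by (meson split_list)
  have "set xs \<union> set ys = set \<pi> - {Suc n}"
    using \<pi>(1) split by auto
  also have "\<dots> = {1..n}" by (simp add: \<pi>(2) atLeastAtMostSuc_conv)
  finally have sets: "set xs \<union> set ys = {1..n}" .
  then have mem: "a \<in> set xs \<or> a \<in> set ys \<longleftrightarrow> 1 \<le> a \<and> a \<le> n" for a
    by (metis Un_iff atLeastAtMost_iff)
  then have lt: "\<forall>x \<in> set xs. x < Suc n" "\<forall>y \<in> set ys. y < Suc n"
    unfolding less_Suc_eq_le by blast+
  show ?thesis
  proof (cases xs)
    case Nil
    then have "ys \<in> avoiding_perms n"
      using \<pi> sets split by (auto simp: avoiding_perms_def)
    then show ?thesis using Nil split by simp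
  next
    case (Cons x xs')
    have less: "a < b" if "a \<in> set xs" "b \<in> set ys" for a b
    proof -
      have "a \<le> b" using avoiding_before_after[of xs "Suc n" ys] \<pi>(3) split lt that by blast
      moreover have "a \<noteq> b" using \<pi>(1) split that by auto
      ultimately show ?thesis by simp
    qed
    \<comment> \<open>The cut between the runs: the values up to \<open>k\<close> turn out to be
      those before the maximum.\<close>
    define k where "k = Max (set xs)"
    have k: "k \<in> set xs" "\<And>a. a \<in> set xs \<Longrightarrow> a \<le> k"
      using Cons by (auto simp: k_def simp del: set_simps intro: Max_in)
    have range: "1 \<le> k" "k \<le> n" using k(1) mem by blast+
    have xs_iff: "a \<in> set xs \<longleftrightarrow> 1 \<le> a \<and> a \<le> k" for a
      using k mem[of a] less[of k a] range by (meson le_trans not_le)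
    have ys_iff: "b \<in> set ys \<longleftrightarrow> k < b \<and> b \<le> n" for b
      using k(1) mem[of b] less[of k b] range xs_iff[of b] by linarith
    have xs_set: "set xs = {1..<Suc k}"
      using xs_iff by (simp add: set_eq_iff less_Suc_eq_le)
    have ys_set: "set (Suc n # ys) = {Suc k..<Suc (Suc n)}"
      using ys_iff range by (simp add: set_eq_iff) presburger
    have "xs = rev [1..<Suc k]"
      using avoiding_before_decreasing[of xs "Suc n" ys] \<pi> split lt xs_set
      by (intro decreasing_eq_rev_upt) auto
    moreover have "sorted_wrt (>) (Suc n # ys)"
    proof -
      \<comment> \<open>Dropping letters keeps a word avoiding, and \<open>x\<close>, taken from
        before the maximum, lies below all of \<open>ys\<close>.\<close>
      have "avoiding (x # ys)"
        using \<pi>(3) unfolding split Cons by (induction xs') (auto simp: sorted_wrt_append)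
      then have "sorted_wrt (>) ys"
        using less \<pi>(1) split Cons by (intro avoiding_after_decreasing) auto
      then show ?thesis using lt by simp
    qed
    then have "Suc n # ys = rev [Suc k..<Suc (Suc n)]"
      using ys_set by (rule decreasing_eq_rev_upt)
    ultimately have "\<pi> = two_runs (Suc n) k"
      by (simp add: split two_runs_def del: upt_Suc)
    then show ?thesis using range by auto
  qed
qed

lemma avoiding_perms_Suc:
  "avoiding_perms (Suc n) = (#) (Suc n) ` avoiding_perms n \<union> two_runs (Suc n) ` {1..n}"
  using avoiding_perms_Suc_cases Cons_in_avoiding_perms two_runs_in_avoiding_perms[of _ "Suc n"] by auto

section \<open>Summing over the avoiding permutations\<close>

lemma hd_two_runs: "1 \<le> k \<Longrightarrow> hd (two_runs n k) = k"
  by (simp add: two_runs_def)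

lemma finite_avoiding_perms: "finite (avoiding_perms n)"
  by (induction n) (auto simp: avoiding_perms_0 avoiding_perms_Suc)

text \<open>The letters from \<open>k\<close> down to 2 are stripped as descents. The remaining word
  starts with the only ascent, from 1 to \<open>n + 1\<close>, and the decreasing run after the 1
  has \<open>n + 1 - k\<close> letters.\<close>

lemma card_completions_two_runs:
  assumes "1 \<le> k" "k \<le> n"
  shows "card (completions 0 (two_runs (Suc n) k)) = Suc (Suc n - k)"
proof -
  have "[1..<Suc k] = 1 # [2..<Suc k]"
    using assms by (subst upt_conv_Cons) (auto simp: numeral_2_eq_2)
  then have "two_runs (Suc n) k = rev [2..<Suc k] @ 1 # rev [Suc k..<Suc (Suc n)]"
    by (simp add: two_runs_def del: upt_Suc One_nat_def)
  moreover have "sorted_wrt (>) (rev [2..<Suc k] @ [1])"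
    by (auto simp: sorted_wrt_append sorted_wrt_greater_rev_upt simp del: upt_Suc)
  ultimately have "card (completions 0 (two_runs (Suc n) k))
      = card (completions 0 (1 # rev [Suc k..<Suc (Suc n)]))"
    by (simp add: card_completions_0_descents del: upt_Suc)
  also have "\<dots> = Suc (length (rev [Suc k..<Suc (Suc n)]))"
    using assms by (intro card_completions_0_ascent sorted_wrt_greater_rev_upt) auto
  finally show ?thesis using assms by (simp del: upt_Suc)
qed

lemma sum_card_completions:
  "(\<Sum>\<pi> \<in> avoiding_perms n. card (completions 0 \<pi>)) = ((n + 1) choose 3) + (n choose 2) + 1"
proof (induction n)
  case 0
  then show ?case by (simp add: avoiding_perms_0 completions_0_Nil)
next
  case (Suc n)
  \<comment> \<open>The first letter gives back \<open>k\<close>.\<close>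
  have "inj_on (two_runs (Suc n)) {1..n}"
    by (rule inj_onI) (metis atLeastAtMost_iff hd_two_runs)
  then have "(\<Sum>\<pi> \<in> two_runs (Suc n) ` {1..n}. card (completions 0 \<pi>))
      = (\<Sum>k = 1..n. Suc (Suc n - k))"
    by (simp add: sum.reindex card_completions_two_runs)
  \<comment> \<open>The index is reversed, \<open>k\<close> becoming
    \<open>n + 1 - k\<close>.\<close>
  also have "\<dots> = (\<Sum>k = 1..n. Suc k)"
    by (subst sum.atLeastAtMost_rev) (auto intro: sum.cong)
  also have "\<dots> = n + (Suc n choose 2)"
    by (induction n) (auto simp: numeral_2_eq_2)
  finally have runs: "(\<Sum>\<pi> \<in> two_runs (Suc n) ` {1..n}. card (completions 0 \<pi>)) = \<dots>" .
  have "card (completions 0 (Suc n # \<pi>)) = card (completions 0 \<pi>)" if "\<pi> \<in> avoiding_perms n" for \<pi>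
  proof (rule card_completions_0_descent)
    assume "\<pi> \<noteq> []"
    then have "hd \<pi> \<in> {1..n}" using that hd_in_set unfolding avoiding_perms_def by blast
    then show "hd \<pi> < Suc n" by simp
  qed
  then have "(\<Sum>\<pi> \<in> (#) (Suc n) ` avoiding_perms n. card (completions 0 \<pi>))
      = (\<Sum>\<pi> \<in> avoiding_perms n. card (completions 0 \<pi>))"
    by (simp add: sum.reindex)
  moreover have "(#) (Suc n) ` avoiding_perms n \<inter> two_runs (Suc n) ` {1..n} = {}"
  proof -
    have "hd (two_runs (Suc n) k) \<noteq> Suc n" if "k \<in> {1..n}" for k
      using that by (simp add: hd_two_runs)
    then show ?thesis by (metis (no_types, lifting) disjoint_iff imageE list.sel(1))
  qed
  \<comment> \<open>By Pascal's rule \<open>Suc n choose 2\<close> is the increment of the first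
    binomial coefficient and \<open>n\<close> that of the second.\<close>
  ultimately show ?case
    unfolding avoiding_perms_Suc
    using Suc.IH runs
    by (simp add: sum.union_disjoint finite_avoiding_perms numeral_3_eq_3 numeral_2_eq_2)
qed

theorem theorem18:
  fixes n :: nat
  assumes "n \<ge> 1"
  shows "pf n {[1, 2, 3], [2, 3, 1]} = ((n + 1) choose 3) + (n choose 2) + 1"
proof -
  have "{p. parking_function n p \<and> (\<forall>\<rho> \<in> {[1, 2, 3], [2, 3, 1]}. avoids (phi p) \<rho>)}
      = (\<Union>\<pi> \<in> avoiding_perms n. completions 0 \<pi>)"
    by (auto simp: parking_function_iff phi_def avoiding_perms_def avoiding_iff completions_def)
  then have "pf n {[1, 2, 3], [2, 3, 1]} = card (\<Union>\<pi> \<in> avoiding_perms n. completions 0 \<pi>)"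
    by (simp add: pf_def)
  \<comment> \<open>A completion determines its label word, so the parking functions split into
    disjoint classes according to \<open>phi\<close>.\<close>
  also have "\<dots> = (\<Sum>\<pi> \<in> avoiding_perms n. card (completions 0 \<pi>))"
  proof (rule card_UN_disjoint)
    show "\<forall>\<pi> \<in> avoiding_perms n. \<forall>\<rho> \<in> avoiding_perms n.
        \<pi> \<noteq> \<rho> \<longrightarrow> completions 0 \<pi> \<inter> completions 0 \<rho> = {}"
      by (auto simp: completions_def)
  qed (simp_all add: finite_avoiding_perms finite_completions)
  finally show ?thesis by (simp only: sum_card_completions)
qed

end
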